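(* Let $n$ be a positive integer and let $c>0$ and $x_0>0$ be real numbers such that for every real $x \geq x_0$ there is a prime $p$ with $$x < p \leq x\left(1+\frac{c}{\log^n x}\right).$$ Then for every real $$k \in \left(1,\ 1+\frac{c}{\log^n x_0}\right]$$ we have $$R_1^{(k)} \leq k\cdot \exp\left(\sqrt[n]{\frac{c}{k-1}}\right).$$
   Context: $\pi(x)$ denotes the number of primes $\leq x$, and $\log^n x = (\log x)^n$ with $\log$ the natural logarithm. For real $k>1$ and a positive integer $m$, the $m$th $k$-Ramanujan prime is $$R_m^{(k)} = \min\{ M \in \mathbb{N} \mid \pi(x)-\pi(x/k) \geq m \text{ for every real } x \geq M\},$$ where $\mathbb{N}$ is the set of positive integers; this minimum exists by the Prime Number Theorem. In particular $R_1^{(k)}$ is the least positive integer $M$ such that for every real $x\ge M$ the interval $(x/k,x]$ contains a prime. *)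

theory Defs
  imports Complex_Main "HOL-Computational_Algebra.Primes"
begin

definition prime_pi :: "real \<Rightarrow> nat" where
  "prime_pi x = card {p :: nat. prime p \<and> real p \<le> x}"

text \<open>
  The minimum exists for all \<open>k > 1\<close> and \<open>m \<ge> 1\<close> (Prime Number Theorem);
  outside this range the value has no meaning. The prime counts are subtracted in the
  integers, since subtraction on the natural numbers truncates.
\<close>
definition ramanujan_prime :: "real \<Rightarrow> nat \<Rightarrow> nat" where
  "ramanujan_prime k m =
     (LEAST M :: nat. M \<ge> 1 \<and>
        (\<forall>x :: real. x \<ge> real M \<longrightarrow> int (prime_pi x) - int (prime_pi (x / k)) \<ge> int m))"

end

(* With X = exp (root n (c / (k - 1))), the hypothesis on k says X \<ge> x0, and for
   y \<ge> X the prime supplied in (y, y (1 + c / (ln y)^n)] lies in (y, k y]. So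
   pi(x) - pi(x/k) \<ge> 1 for x \<ge> k X. This extends to every x \<ge> floor (k X), since pi is
   constant on [floor (k X), k X] while x/k \<le> X; thus rounding to an integer costs nothing. *)
theory Submission
  imports Defs
begin

lemma finite_primes_le: "finite {p :: nat. prime p \<and> real p \<le> x}"
proof (rule finite_subset)
  show "{p :: nat. prime p \<and> real p \<le> x} \<subseteq> {..nat \<lfloor>x\<rfloor>}"
    by (auto simp: le_nat_floor)
qed simp

lemma prime_pi_mono: "x \<le> y \<Longrightarrow> prime_pi x \<le> prime_pi y"
  unfolding prime_pi_def by (intro card_mono finite_primes_le) auto

lemma prime_pi_less:
  assumes "prime p" "x < real p" "real p \<le> y"
  shows "prime_pi x < prime_pi y"
  unfolding prime_pi_def
proof (intro psubset_card_mono finite_primes_le psubsetI)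
  show "{p. prime p \<and> real p \<le> x} \<noteq> {p. prime p \<and> real p \<le> y}"
    using assms by (auto simp: set_eq_iff intro!: exI[of _ p])
qed (use assms in auto)

text \<open>Primes are integers, so none lies strictly above the floor of \<open>x\<close> and at
  most \<open>x\<close>. This is what allows a real bound to be rounded down.\<close>

lemma prime_pi_floor: "prime_pi (of_int \<lfloor>x\<rfloor>) = prime_pi x"
proof -
  have "real p \<le> of_int \<lfloor>x\<rfloor> \<longleftrightarrow> real p \<le> x" for p
    by (metis le_floor_iff of_int_le_iff of_int_of_nat_eq)
  then show ?thesis by (simp add: prime_pi_def)
qed

text \<open>The hypothesis is phrased with \<open>y = x / k\<close>, so that
  \<open>(x / k, x]\<close> becomes \<open>(y, k * y]\<close>. The condition
  \<open>B \<ge> 1\<close> makes the floor of \<open>B\<close> a positive integer, hence an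
  admissible \<open>M\<close>.\<close>

lemma ramanujan_prime_1_le:
  fixes k B :: real
  assumes k: "k > 0" and B: "B \<ge> 1"
    and primes: "\<And>y. k * y \<ge> B \<Longrightarrow> \<exists>p. prime p \<and> y < real p \<and> real p \<le> k * y"
  shows "real (ramanujan_prime k 1) \<le> B"
proof -
  define M where "M = nat \<lfloor>B\<rfloor>"
  have M: "real M = of_int \<lfloor>B\<rfloor>" "M \<ge> 1"
    using B by (auto simp: M_def le_nat_iff)
  have less: "prime_pi (x / k) < prime_pi x" if "x \<ge> B" for x
    using primes[of "x / k"] that k by (auto intro: prime_pi_less)
  have "prime_pi (x / k) < prime_pi x" if x: "x \<ge> real M" for x
  proof (cases "x \<ge> B")
    \<comment> \<open>Here \<open>real M \<le> x < B\<close>: replacing \<open>x\<close> by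
      \<open>B\<close> can only raise the count at \<open>x / k\<close>, and it adds no prime to the
      count at \<open>x\<close>.\<close>
    case False
    have "prime_pi (x / k) \<le> prime_pi (B / k)"
      using False k by (intro prime_pi_mono divide_right_mono) auto
    also have "\<dots> < prime_pi B" by (rule less) simp
    also have "\<dots> = prime_pi (real M)" using prime_pi_floor M(1) by simp
    also have "\<dots> \<le> prime_pi x" by (rule prime_pi_mono[OF x])
    finally show ?thesis .
  qed (rule less)
  then have "\<forall>x. x \<ge> real M \<longrightarrow> int (prime_pi x) - int (prime_pi (x / k)) \<ge> int 1"
    by fastforce
  then have "ramanujan_prime k 1 \<le> M"
    unfolding ramanujan_prime_def using M(2) by (intro Least_le) auto
  then show ?thesis using M(1) by linarith
qed

theorem corollary3p2:
  fixes n :: nat and c x0 :: real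
  assumes "n > 0" and "c > 0" and "x0 > 0"
    and "\<And>x :: real. x \<ge> x0 \<Longrightarrow> \<exists>p :: nat. prime p \<and> x < real p \<and> real p \<le> x * (1 + c / (ln x) ^ n)"
  shows "\<forall>k :: real. k \<in> {1 <.. 1 + c / (ln x0) ^ n} \<longrightarrow>
           real (ramanujan_prime k 1) \<le> k * exp (root n (c / (k - 1)))"
proof (intro allI impI)
  fix k :: real
  assume k: "k \<in> {1 <.. 1 + c / (ln x0) ^ n}"
  \<comment> \<open>At \<open>x = 1\<close> the junk value \<open>c / 0 = 0\<close> makes the prime interval empty.\<close>
  have x0: "x0 > 1"
    using assms(4)[of 1] \<open>n > 0\<close> by (cases "x0 \<le> 1") (auto simp: power_0_left)
  \<comment> \<open>\<open>r\<close> is the positive solution of \<open>1 + c / r ^ n = k\<close>: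
    at \<open>exp r\<close> the given interval factor is exactly \<open>k\<close>.\<close>
  define r where "r = root n (c / (k - 1))"
  have r: "r > 0" "r ^ n = c / (k - 1)"
    using k \<open>n > 0\<close> \<open>c > 0\<close> by (auto simp: r_def)
  have lnx0: "ln x0 > 0" using x0 by simp
  \<comment> \<open>This is the upper bound on \<open>k\<close> solved for
    \<open>(ln x0) ^ n\<close>; clearing denominators uses \<open>ln x0 > 0\<close> and
    \<open>k > 1\<close>.\<close>
  have "(ln x0) ^ n \<le> r ^ n"
    using k lnx0 by (simp add: r(2) field_simps)
  then have "ln x0 \<le> r"
    using \<open>n > 0\<close> r(1) lnx0 by (simp add: power_mono_iff)
  then have x0_le: "x0 \<le> exp r"
    using x0 by (metis exp_le_cancel_iff exp_ln less_trans zero_less_one)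
  have "real (ramanujan_prime k 1) \<le> k * exp r"
  proof (rule ramanujan_prime_1_le)
    show "k > 0" using k by simp
    show "k * exp r \<ge> 1"
      using k r(1) mult_mono[of 1 k 1 "exp r"] by simp
    fix y assume "k * y \<ge> k * exp r"
    then have y: "y \<ge> exp r" using k by simp
    then have "y > 0" using exp_gt_zero[of r] by linarith
    then have "r \<le> ln y" using y by (simp add: ln_ge_iff)
    \<comment> \<open>As \<open>c / t ^ n\<close> decreases for \<open>t > 0\<close>, moving from
      \<open>t = r\<close> to \<open>t = ln y\<close> keeps the factor \<open>1 + c / t ^ n\<close>
      at most \<open>k\<close>.\<close>
    then have "c / (k - 1) \<le> (ln y) ^ n"
      using r power_mono[of r "ln y" n] by simp
    then have "c \<le> (k - 1) * (ln y) ^ n"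
      using k by (simp add: pos_divide_le_eq mult.commute)
    moreover have "(ln y) ^ n > 0" using \<open>r \<le> ln y\<close> r(1) by simp
    ultimately have "c / (ln y) ^ n \<le> k - 1"
      by (metis pos_divide_le_eq)
    then have le: "y * (1 + c / (ln y) ^ n) \<le> k * y"
      using \<open>y > 0\<close> by (subst mult.commute) (intro mult_right_mono, auto)
    obtain p where "prime p" "y < real p" "real p \<le> y * (1 + c / (ln y) ^ n)"
      using assms(4)[of y] x0_le y by auto
    with le show "\<exists>p. prime p \<and> y < real p \<and> real p \<le> k * y"
      by (blast intro: order_trans)
  qed
  then show "real (ramanujan_prime k 1) \<le> k * exp (root n (c / (k - 1)))"
    by (simp add: r_def)
qed

end
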